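(* Let $T$ be a weak mixing $\mathbb{R}^d$-action or a weak mixing $\mathbb{Z}^d$-action. Then $\mathcal{E}_T=\mathcal{W}_T$; that is, for each linear subspace $L\in\mathbb{G}_{e,d}$, $1\le e\le d$, $T$ is ergodic in the direction $L$ if and only if $T$ is weak mixing in the direction $L$.
   Context: All actions are free measurable measure preserving actions on a Lebesgue probability space $(X,\mu)$. An action is ergodic (weak mixing) if the only invariant $L^2$ functions ($L^2$ eigenfunctions) are constants. $\mathbb{G}_{e,d}$ is the set of $e$-dimensional linear subspaces of $\mathbb{R}^d$. Directional properties are defined for $L\in\mathbb{G}_{e,d}$ with $1\le e\le d$; $\mathcal{E}_T$ and $\mathcal{W}_T$ denote the sets of those $L$ in whose direction $T$ is ergodic, respectively weak mixing. For an $\mathbb{R}^d$-action $T$: $T$ is ergodic (weak mixing) in the direction $L$ if the $L$-action $\{T^{\vec t}\}_{\vec t\in L}$ is ergodic (weak mixing). For a $\mathbb{Z}^d$-action $T$: let $\widetilde T$ be the unit suspension, i.e. the $\mathbb{R}^d$-action on $(\widetilde X,\tilde\mu)=(X\times[0,1)^d,\mu\times\lambda)$, $\lambda$ Lebesgue measure, given by $\widetilde T^{\vec t}(x,\vec r)=(T^{\lfloor\vec t+\vec r\rfloor}x,\{\vec t+\vec r\})$, with componentwise integer part $\lfloor\cdot\rfloor$ and fractional part $\{\cdot\}$. Let $\mathcal{O}=\{F(x,\vec s)=f(\vec s): f\in L^2([0,1)^d,\lambda)\}$ and $L^2_{\mathcal{O}}(\widetilde X,\tilde\mu)=\mathcal{O}^\perp\subseteq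 L^2(\widetilde X,\tilde\mu)$. A nonzero $F\in L^2(\widetilde X,\tilde\mu)$ is a direction $L$ eigenfunction of $\widetilde T$ if for some $\vec\ell\in L$, $F(\widetilde T^{\vec t}y)=e^{2\pi i\vec\ell\cdot\vec t}F(y)$ for all $\vec t\in L$ and a.e. $y$, and direction $L$ invariant if this holds with $\vec\ell=\vec 0$. $T$ is ergodic (weak mixing) in the direction $L$ if $\widetilde T$ has no nonzero direction $L$ invariant function (direction $L$ eigenfunction) in $L^2_{\mathcal{O}}(\widetilde X,\tilde\mu)$. *)

theory Defs
  imports "HOL-Probability.Probability"
begin

text \<open>
  Isomorphism modulo null sets with the unit interval is required of the completion of
  \<open>M\<close>, so that \<open>M\<close> itself may be complete or merely standard Borel. Only the non-atomic
  case is considered: a Lebesgue probability space with atoms carries no free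
  measure-preserving action of an infinite group.
\<close>
definition lebesgue_probability_space :: "'a measure \<Rightarrow> bool" where
  "lebesgue_probability_space M \<longleftrightarrow> prob_space M \<and>
    (\<exists>A\<in>sets (completion M). \<exists>B\<in>sets (lebesgue_on {0..1::real}). \<exists>\<phi>.
       space M - A \<in> null_sets (completion M) \<and>
       {0..1} - B \<in> null_sets (lebesgue_on {0..1}) \<and>
       bij_betw \<phi> A B \<and>
       \<phi> \<in> restrict_space (completion M) A \<rightarrow>\<^sub>M lebesgue_on B \<and>
       inv_into A \<phi> \<in> lebesgue_on B \<rightarrow>\<^sub>M restrict_space (completion M) A \<and>
       distr (restrict_space (completion M) A) (lebesgue_on B) \<phi> = lebesgue_on B)"

definition measure_preserving_action ::
    "'a measure \<Rightarrow> ('g::ab_group_add \<Rightarrow> 'a \<Rightarrow> 'a) \<Rightarrow> bool" where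
  "measure_preserving_action M T \<longleftrightarrow>
    (\<forall>g. T g \<in> M \<rightarrow>\<^sub>M M \<and> distr M M (T g) = M) \<and>
    (\<forall>x\<in>space M. T 0 x = x) \<and>
    (\<forall>g h. \<forall>x\<in>space M. T (g + h) x = T g (T h x))"

definition free_action :: "'a measure \<Rightarrow> ('g::ab_group_add \<Rightarrow> 'a \<Rightarrow> 'a) \<Rightarrow> bool" where
  "free_action M T \<longleftrightarrow> (AE x in M. \<forall>g. g \<noteq> 0 \<longrightarrow> T g x \<noteq> x)"

text \<open>
  Joint measurability is with respect to the completed product: for a complete \<open>M\<close> the map
  \<open>(t, x) \<mapsto> T t x\<close> is in general not measurable for the uncompleted product
  (already for \<open>\<real>\<close> acting on the circle by rotations).
\<close>
definition Rd_action :: "'a measure \<Rightarrow> (real ^ 'd \<Rightarrow> 'a \<Rightarrow> 'a) \<Rightarrow> bool" where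
  "Rd_action M T \<longleftrightarrow> measure_preserving_action M T \<and> free_action M T \<and>
    (\<lambda>(t, x). T t x) \<in> completion (lborel \<Otimes>\<^sub>M M) \<rightarrow>\<^sub>M M"

definition Zd_action :: "'a measure \<Rightarrow> (int ^ 'd \<Rightarrow> 'a \<Rightarrow> 'a) \<Rightarrow> bool" where
  "Zd_action M T \<longleftrightarrow> measure_preserving_action M T \<and> free_action M T"

text \<open>Elements of \<open>L\<^sup>2\<close> are handled through representatives.\<close>
definition L2 :: "'a measure \<Rightarrow> ('a \<Rightarrow> complex) set" where
  "L2 M = {F \<in> borel_measurable M. integrable M (\<lambda>x. (cmod (F x))\<^sup>2)}"

definition ae_constant :: "'a measure \<Rightarrow> ('a \<Rightarrow> complex) \<Rightarrow> bool" where
  "ae_constant M F \<longleftrightarrow> (\<exists>c. AE x in M. F x = c)"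

definition L2_eigenfunction_at ::
    "'a measure \<Rightarrow> (real ^ 'd \<Rightarrow> 'a \<Rightarrow> 'a) \<Rightarrow> (real ^ 'd) set \<Rightarrow> real ^ 'd \<Rightarrow> ('a \<Rightarrow> complex) \<Rightarrow> bool"
where
  "L2_eigenfunction_at M T L l F \<longleftrightarrow> F \<in> L2 M \<and> \<not> (AE x in M. F x = 0) \<and>
    (\<forall>t\<in>L. AE x in M. F (T t x) = exp (2 * of_real pi * \<i> * of_real (l \<bullet> t)) * F x)"

definition L2_eigenfunction ::
    "'a measure \<Rightarrow> (real ^ 'd \<Rightarrow> 'a \<Rightarrow> 'a) \<Rightarrow> (real ^ 'd) set \<Rightarrow> ('a \<Rightarrow> complex) \<Rightarrow> bool" where
  "L2_eigenfunction M T L F \<longleftrightarrow> (\<exists>l\<in>L. L2_eigenfunction_at M T L l F)"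

definition L2_invariant ::
    "'a measure \<Rightarrow> (real ^ 'd \<Rightarrow> 'a \<Rightarrow> 'a) \<Rightarrow> (real ^ 'd) set \<Rightarrow> ('a \<Rightarrow> complex) \<Rightarrow> bool" where
  "L2_invariant M T L F \<longleftrightarrow> L2_eigenfunction_at M T L 0 F"

text \<open>The restriction of an \<open>\<real>\<^sup>d\<close>-action to a subspace \<open>L\<close>; \<open>L = UNIV\<close> is the full action.\<close>
definition Rd_ergodic_along ::
    "'a measure \<Rightarrow> (real ^ 'd \<Rightarrow> 'a \<Rightarrow> 'a) \<Rightarrow> (real ^ 'd) set \<Rightarrow> bool" where
  "Rd_ergodic_along M T L \<longleftrightarrow> (\<forall>F. L2_invariant M T L F \<longrightarrow> ae_constant M F)"

definition Rd_weak_mixing_along ::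
    "'a measure \<Rightarrow> (real ^ 'd \<Rightarrow> 'a \<Rightarrow> 'a) \<Rightarrow> (real ^ 'd) set \<Rightarrow> bool" where
  "Rd_weak_mixing_along M T L \<longleftrightarrow> (\<forall>F. L2_eigenfunction M T L F \<longrightarrow> ae_constant M F)"

definition Zd_weak_mixing :: "'a measure \<Rightarrow> (int ^ 'd \<Rightarrow> 'a \<Rightarrow> 'a) \<Rightarrow> bool" where
  "Zd_weak_mixing M T \<longleftrightarrow>
    (\<forall>F\<in>L2 M. \<forall>l :: real ^ 'd.
       \<not> (AE x in M. F x = 0) \<longrightarrow>
       (\<forall>n. AE x in M.
          F (T n x) = exp (2 * of_real pi * \<i> * of_real (l \<bullet> (\<chi> i. real_of_int (n $ i)))) * F x) \<longrightarrow>
       ae_constant M F)"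

definition unit_cube :: "(real ^ 'd) set" where
  "unit_cube = {r. \<forall>i. 0 \<le> r $ i \<and> r $ i < 1}"

definition cube_measure :: "(real ^ 'd) measure" where
  "cube_measure = restrict_space lborel unit_cube"

definition suspension_measure :: "'a measure \<Rightarrow> ('a \<times> (real ^ 'd)) measure" where
  "suspension_measure M = M \<Otimes>\<^sub>M cube_measure"

definition suspension ::
    "(int ^ 'd \<Rightarrow> 'a \<Rightarrow> 'a) \<Rightarrow> real ^ 'd \<Rightarrow> 'a \<times> (real ^ 'd) \<Rightarrow> 'a \<times> (real ^ 'd)" where
  "suspension T t = (\<lambda>(x, r). (T (\<chi> i. \<lfloor>(t + r) $ i\<rfloor>) x, \<chi> i. frac ((t + r) $ i)))"

definition cube_functions :: "('a \<times> (real ^ 'd) \<Rightarrow> complex) set" where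
  "cube_functions = {(\<lambda>(x, s). f s) | f. f \<in> L2 cube_measure}"

definition L2_cube_perp :: "'a measure \<Rightarrow> ('a \<times> (real ^ 'd) \<Rightarrow> complex) set" where
  "L2_cube_perp M = {F \<in> L2 (suspension_measure M).
     \<forall>H\<in>cube_functions. (\<integral>y. F y * cnj (H y) \<partial>suspension_measure M) = 0}"

definition Zd_ergodic_along ::
    "'a measure \<Rightarrow> (int ^ 'd \<Rightarrow> 'a \<Rightarrow> 'a) \<Rightarrow> (real ^ 'd) set \<Rightarrow> bool" where
  "Zd_ergodic_along M T L \<longleftrightarrow>
    \<not> (\<exists>F\<in>L2_cube_perp M. L2_invariant (suspension_measure M) (suspension T) L F)"

definition Zd_weak_mixing_along ::
    "'a measure \<Rightarrow> (int ^ 'd \<Rightarrow> 'a \<Rightarrow> 'a) \<Rightarrow> (real ^ 'd) set \<Rightarrow> bool" where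
  "Zd_weak_mixing_along M T L \<longleftrightarrow>
    \<not> (\<exists>F\<in>L2_cube_perp M. L2_eigenfunction (suspension_measure M) (suspension T) L F)"

definition grassmannian :: "nat \<Rightarrow> (real ^ 'd) set set" where
  "grassmannian e = {L. subspace L \<and> dim L = e}"

definition directions :: "((real ^ 'd) set \<Rightarrow> bool) \<Rightarrow> (real ^ 'd) set set" where
  "directions P = {L. (\<exists>e\<in>{1..CARD('d)}. L \<in> grassmannian e) \<and> P L}"

end

theory Submission
  imports Defs
begin

text \<open>
  Directional weak mixing clearly implies directional ergodicity. For the converse, let \<open>F\<close> be an
  eigenfunction in the direction \<open>L\<close>, bounded without loss of generality. The acting group is
  abelian, so moving \<open>F\<close> by any element \<open>s\<close> of the group yields another eigenfunction with the same
  eigenvalue, and the autocorrelation \<open>F (T s x) * cnj (F x)\<close> is invariant in the direction \<open>L\<close>.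

  For an action of \<open>\<real>\<^sup>d\<close> all autocorrelations are constant by ergodicity in the direction \<open>L\<close>.
  Hence \<open>F (T s x) = \<psi> s * F x\<close> for a character \<open>\<psi>\<close> of \<open>\<real>\<^sup>d\<close>
  (\<open>constant_autocorrelations_imp_eigenfunction\<close>). Joint measurability of the action makes \<open>\<psi>\<close>
  measurable, hence continuous, hence of the form \<open>exp (2 * pi * \<i> * (l \<bullet> s))\<close>
  (\<open>measurable_character_continuous\<close>, \<open>continuous_character_exponential\<close>). So \<open>F\<close> is an
  eigenfunction of the whole action, and constant by weak mixing.

  For an action of \<open>\<int>\<^sup>d\<close> the same is done in the suspension with integer times \<open>s = n\<close>, which move
  only the base point \<open>x\<close>. Ergodicity in the direction \<open>L\<close> says that invariant functions depend on the cube
  coordinate \<open>r\<close> alone (\<open>bounded_invariant_fibrewise_constant\<close>). So for almost every \<open>r\<close> the section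
  \<open>F (_, r)\<close> has constant autocorrelations; it is null or an eigenfunction of the weakly mixing lattice action, and
  constant either way. So the eigenfunction that was made bounded is a cube function as well, which
  contradicts its orthogonality to all cube functions
  (\<open>perp_fibrewise_constant_imp_zero\<close>).
\<close>

section \<open>Characters of Euclidean space and of the integer lattice\<close>

text \<open>
  The density \<open>1 + g\<close> is nonnegative and gives every box its volume. Lebesgue measure is the
  only Borel measure with this property, so the density is almost everywhere \<open>1\<close>.
\<close>
lemma AE_zero_if_box_integrals_zero_real:
  fixes g :: "'a::euclidean_space \<Rightarrow> real"
  assumes g[measurable]: "g \<in> borel_measurable borel" and bound: "\<And>x. \<bar>g x\<bar> \<le> 1"
    and zero: "\<And>a b. (\<integral>x. indicator (box a b) x * g x \<partial>lborel) = 0"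
  shows "AE x in lborel. g x = 0"
proof -
  define N where "N = density lborel (\<lambda>x. ennreal (1 + g x))"
  have nonneg: "0 \<le> 1 + g x" for x
    using bound[of x] by linarith
  have "lborel = N"
  proof (rule lborel_eqI)
    fix l u :: 'a
    assume le: "\<And>b. b \<in> Basis \<Longrightarrow> l \<bullet> b \<le> u \<bullet> b"
    have I: "integrable lborel (indicator (box l u) :: 'a \<Rightarrow> real)"
      by (rule integrable_real_indicator) (use emeasure_bounded_finite[OF bounded_box] in simp_all)
    have Ig: "integrable lborel (\<lambda>x. indicator (box l u) x * g x)"
      by (rule Bochner_Integration.integrable_bound[OF I])
         (use bound in \<open>auto simp: indicator_def\<close>)
    have "emeasure N (box l u) = (\<integral>\<^sup>+x. ennreal (1 + g x) * indicator (box l u) x \<partial>lborel)"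
      unfolding N_def by (subst emeasure_density) auto
    also have "\<dots> = (\<integral>\<^sup>+x. ennreal (indicator (box l u) x + indicator (box l u) x * g x) \<partial>lborel)"
      by (intro nn_integral_cong) (auto simp: indicator_def)
    also have "\<dots> = ennreal (\<integral>x. indicator (box l u) x + indicator (box l u) x * g x \<partial>lborel)"
      using nonneg
      by (intro nn_integral_eq_integral Bochner_Integration.integrable_add I Ig)
         (auto simp: indicator_def)
    also have "\<dots> = ennreal (measure lborel (box l u))"
      using I Ig zero by simp
    also have "\<dots> = emeasure lborel (box l u)"
      using emeasure_lborel_box_finite[of l u] by (simp add: emeasure_eq_ennreal_measure)
    finally show "emeasure N (box l u) = (\<Prod>b\<in>Basis. (u - l) \<bullet> b)"
      using le by simp
  qed (simp add: N_def)
  then have "density lborel (\<lambda>x. ennreal (1 + g x)) = density lborel (\<lambda>_. 1)"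
    unfolding N_def density_1 ..
  then have "AE x in lborel. ennreal (1 + g x) = 1"
    by (subst (asm) sigma_finite_measure.density_unique_iff[OF sigma_finite_lborel]) auto
  then show ?thesis
    by eventually_elim (use nonneg in \<open>auto simp: ennreal_eq_1\<close>)
qed

lemma AE_zero_if_box_integrals_zero:
  fixes f :: "'a::euclidean_space \<Rightarrow> complex"
  assumes f[measurable]: "f \<in> borel_measurable borel" and bound: "\<And>x. cmod (f x) \<le> 1"
    and zero: "\<And>a b. (\<integral>x. indicator (box a b) x *\<^sub>R f x \<partial>lborel) = 0"
  shows "AE x in lborel. f x = 0"
proof -
  have int: "integrable lborel (\<lambda>x. indicator (box a b) x *\<^sub>R f x)" for a b :: 'a
  proof (rule Bochner_Integration.integrable_bound)
    show "integrable lborel (indicator (box a b) :: 'a \<Rightarrow> real)"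
      by (rule integrable_real_indicator) (use emeasure_bounded_finite[OF bounded_box] in simp_all)
  qed (use bound in \<open>auto simp: indicator_def\<close>)
  have "AE x in lborel. Re (f x) = 0"
  proof (rule AE_zero_if_box_integrals_zero_real)
    fix a b :: 'a
    have "(\<integral>x. indicator (box a b) x * Re (f x) \<partial>lborel) = Re (\<integral>x. indicator (box a b) x *\<^sub>R f x \<partial>lborel)"
      by (subst integral_Re[OF int, symmetric]) simp
    then show "(\<integral>x. indicator (box a b) x * Re (f x) \<partial>lborel) = 0"
      by (simp only: zero) simp
  qed (measurable, rule order_trans[OF abs_Re_le_cmod bound])
  moreover have "AE x in lborel. Im (f x) = 0"
  proof (rule AE_zero_if_box_integrals_zero_real)
    fix a b :: 'a
    have "(\<integral>x. indicator (box a b) x * Im (f x) \<partial>lborel) = Im (\<integral>x. indicator (box a b) x *\<^sub>R f x \<partial>lborel)"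
      by (subst integral_Im[OF int, symmetric]) simp
    then show "(\<integral>x. indicator (box a b) x * Im (f x) \<partial>lborel) = 0"
      by (simp only: zero) simp
  qed (measurable, rule order_trans[OF abs_Im_le_cmod bound])
  ultimately show ?thesis
    by eventually_elim (simp add: complex_eq_iff)
qed

lemma AE_lborel_translate:
  fixes s :: "'a::euclidean_space"
  assumes "AE x in lborel. P x"
  shows "AE x in lborel. P (s + x)"
proof -
  have "AE x in distr lborel borel ((+) s). P x"
    using assms by (simp only: lborel_distr_plus)
  then show ?thesis
    by (rule AE_distrD[rotated]) measurable
qed

text \<open>
  The function \<open>f\<close> is merely measurable, but the domain of integration \<open>s + box a b\<close> varies
  continuously with \<open>s\<close> up to the boundary of a box, which is a null set. Dominated convergence
  does the rest.
\<close>
lemma continuous_translated_box_integral: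
  fixes f :: "'a::euclidean_space \<Rightarrow> complex"
  assumes f[measurable]: "f \<in> borel_measurable borel" and bound: "\<And>x. cmod (f x) \<le> 1"
  shows "continuous_on UNIV (\<lambda>s. \<integral>t. indicator (box a b) (t - s) *\<^sub>R f t \<partial>lborel)"
proof (rule continuous_on_sequentiallyI)
  fix u :: "nat \<Rightarrow> 'a" and s
  assume u: "u \<longlonglongrightarrow> s"
  obtain R where R: "\<And>n. norm (u n) \<le> R"
    using convergent_imp_Bseq[OF convergentI[OF u]] by (auto simp: Bseq_def)
  obtain B where B: "\<And>x. x \<in> box a b \<Longrightarrow> norm x \<le> B"
    using bounded_box[of a b] by (auto simp: bounded_iff)
  show "(\<lambda>n. \<integral>t. indicator (box a b) (t - u n) *\<^sub>R f t \<partial>lborel)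
      \<longlonglongrightarrow> (\<integral>t. indicator (box a b) (t - s) *\<^sub>R f t \<partial>lborel)"
  proof (rule integral_dominated_convergence)
    show "integrable lborel (indicator (cball 0 (B + R)) :: 'a \<Rightarrow> real)"
      by (rule integrable_real_indicator) (use emeasure_bounded_finite[OF bounded_cball] in simp_all)
    have "AE t in lebesgue. t \<notin> frontier (box a b)"
      by (intro AE_not_in)
         (metis negligible_iff_null_sets negligible_convex_frontier convex_box(2))
    then have "AE t in lborel. t \<notin> frontier (box a b)"
      by (simp add: AE_completion_iff)
    from AE_lborel_translate[OF this, of "- s"]
    have "AE t in lborel. t - s \<notin> frontier (box a b)"
      by (simp add: algebra_simps)
    then show "AE t in lborel. (\<lambda>n. indicator (box a b) (t - u n) *\<^sub>R f t)
        \<longlonglongrightarrow> indicator (box a b) (t - s) *\<^sub>R f t"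
    proof eventually_elim
      case (elim t)
      then have "isCont (indicator (box a b) :: 'a \<Rightarrow> real) (t - s)"
        by (simp add: isCont_indicator)
      then show ?case
        by (intro tendsto_intros isCont_tendsto_compose[where g = "indicator (box a b)"] u)
    qed
    show "AE t in lborel. norm (indicator (box a b) (t - u n) *\<^sub>R f t)
        \<le> indicator (cball 0 (B + R)) t" for n
    proof (intro always_eventually allI)
      fix t
      show "norm (indicator (box a b) (t - u n) *\<^sub>R f t) \<le> indicator (cball 0 (B + R)) t"
        using B[of "t - u n"] R[of n] bound[of t] norm_triangle_ineq[of "t - u n" "u n"]
        by (auto simp: indicator_def)
    qed
  qed measurable
qed

text \<open>
  Automatic continuity. Since \<open>\<psi>\<close> vanishes nowhere, its integral over some box is nonzero.
  Multiplicativity pulls \<open>\<psi> s\<close> out of the integral over the box translated by \<open>s\<close>, so \<open>\<psi> s\<close> is the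
  quotient of two box integrals, and the numerator depends continuously on \<open>s\<close>.
\<close>
lemma measurable_character_continuous:
  fixes \<psi> :: "'a::euclidean_space \<Rightarrow> complex"
  assumes hom: "\<And>s t. \<psi> (s + t) = \<psi> s * \<psi> t" and unit: "\<And>s. cmod (\<psi> s) = 1"
    and f: "f \<in> borel_measurable borel" and \<psi>f: "AE s in lborel. \<psi> s = f s"
  shows "continuous_on UNIV \<psi>"
proof -
  \<comment> \<open>A version of the measurable representative that is bounded everywhere.\<close>
  define g where "g s = (if cmod (f s) \<le> 1 then f s else 0)" for s
  have g[measurable]: "g \<in> borel_measurable borel"
    using f unfolding g_def by measurable
  have bound: "cmod (g s) \<le> 1" for s
    by (simp add: g_def)
  have \<psi>g: "AE s in lborel. \<psi> s = g s"
    using \<psi>f by eventually_elim (metis g_def unit order_refl)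
  have "\<not> (AE s in lborel. g s = 0)"
  proof
    assume "AE s in lborel. g s = 0"
    with \<psi>g have "AE s in (lborel :: 'a measure). False"
      by eventually_elim (metis unit norm_zero zero_neq_one)
    then show False
      by (simp add: eventually_const_iff ae_filter_eq_bot_iff)
  qed
  then obtain a b where nz: "(\<integral>t. indicator (box a b) t *\<^sub>R g t \<partial>lborel) \<noteq> 0"
    using AE_zero_if_box_integrals_zero[OF g bound] by blast
  define G where "G s = (\<integral>t. indicator (box a b) (t - s) *\<^sub>R g t \<partial>lborel)" for s
  have "G s = \<psi> s * G 0" for s
  proof -
    have eq: "AE t in lborel. g (s + t) = \<psi> s * g t"
      using AE_lborel_translate[OF \<psi>g, of s] \<psi>g by eventually_elim (metis hom)
    have "G s = (\<integral>t. indicator (box a b) (t - s) *\<^sub>R g t \<partial>distr lborel borel ((+) s))"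
      by (simp only: G_def lborel_distr_plus)
    also have "\<dots> = (\<integral>t. indicator (box a b) t *\<^sub>R g (s + t) \<partial>lborel)"
      by (subst integral_distr) auto
    also have "\<dots> = (\<integral>t. \<psi> s * (indicator (box a b) t *\<^sub>R g t) \<partial>lborel)"
      by (intro integral_cong_AE) (use eq in \<open>auto elim!: eventually_mono\<close>)
    also have "\<dots> = \<psi> s * G 0"
      unfolding G_def by (subst integral_mult_right_zero[symmetric]) simp
    finally show ?thesis .
  qed
  then have "\<psi> s = G s / G 0" for s
    using nz by (simp add: G_def)
  then have "\<psi> = (\<lambda>s. G s / G 0)" ..
  moreover have "continuous_on UNIV G"
    using continuous_translated_box_integral[OF g bound] by (simp add: G_def)
  ultimately show ?thesis
    using nz by (auto intro!: continuous_intros simp: G_def)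
qed

text \<open>
  Additivity yields homogeneity for rational factors; the factors for which homogeneity holds form
  a closed set.
\<close>
lemma continuous_additive_imp_linear:
  fixes f :: "'a::real_normed_vector \<Rightarrow> real"
  assumes cont: "continuous_on UNIV f" and add: "\<And>s t. f (s + t) = f s + f t"
  shows "linear f"
proof (rule linearI)
  fix r :: real and x :: 'a
  have f0: "f 0 = 0"
    using add[of 0 0] by simp
  have fminus: "f (- x) = - f x" for x
    using add[of x "- x"] f0 by simp
  have fnat: "f (real n *\<^sub>R x) = real n * f x" for n x
    by (induction n) (simp_all add: f0 add algebra_simps)
  have fint: "f (real_of_int k *\<^sub>R x) = real_of_int k * f x" for k x
    by (cases k) (use fnat fminus in \<open>simp_all del: of_nat_Suc\<close>)
  define E where "E = {r. f (r *\<^sub>R x) = r * f x}"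
  have "r \<in> E" if rat: "r \<in> \<rat>" for r
  proof -
    obtain k :: int and n :: nat where r: "r = real_of_int k / real n" and n: "n \<noteq> 0"
      using rat unfolding Rats_eq_int_div_nat by blast
    have "real n * f (r *\<^sub>R x) = f (real_of_int k *\<^sub>R x)"
      using n by (simp add: r fnat[symmetric])
    then show ?thesis
      using n by (simp add: E_def fint r field_simps)
  qed
  moreover have "closed E"
    unfolding E_def by (intro closed_Collect_eq continuous_intros continuous_on_compose2[OF cont]) auto
  ultimately have "closure \<rat> \<subseteq> E"
    by (intro closure_minimal) auto
  then show "f (r *\<^sub>R x) = r *\<^sub>R f x"
    by (auto simp: Rats_closure_real E_def)
qed (fact add)

text \<open>
  A continuous character lifts through the exponential map to a function \<open>\<i> * f\<close> with \<open>f\<close> real and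
  \<open>f 0 = 0\<close>. The defect \<open>f (s + t) - f s - f t\<close> is continuous in \<open>(s, t)\<close> and takes values in the
  discrete set \<open>2 * pi * \<int>\<close>, so it vanishes identically. Thus \<open>f\<close> is additive, hence linear, hence
  an inner product with a fixed vector.
\<close>
lemma continuous_character_exponential:
  fixes \<psi> :: "'a::euclidean_space \<Rightarrow> complex"
  assumes hom: "\<And>s t. \<psi> (s + t) = \<psi> s * \<psi> t" and unit: "\<And>s. cmod (\<psi> s) = 1"
    and cont: "continuous_on UNIV \<psi>"
  obtains l where "\<And>s. \<psi> s = exp (2 * of_real pi * \<i> * of_real (l \<bullet> s))"
proof -
  have nz: "\<psi> s \<noteq> 0" for s
    using unit[of s] by auto
  obtain h where hc: "continuous_on UNIV h" and h: "\<And>s. \<psi> s = exp (h s)"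
    by (rule continuous_logarithm_on_contractible[OF cont]) (auto simp: nz)
  define f where "f s = Im (h s) - Im (h 0)" for s
  have fc: "continuous_on UNIV f"
    unfolding f_def by (intro continuous_intros hc)
  have \<psi>0: "\<psi> 0 = 1"
    using hom[of 0 0] nz[of 0] by simp
  have Re: "Re (h s) = 0" for s
    using unit[of s] by (simp add: h)
  have \<psi>f: "\<psi> s = exp (\<i> * of_real (f s))" for s
  proof -
    have "exp (\<i> * of_real (f s)) = exp (h s - h 0)"
      by (rule arg_cong[of _ _ exp]) (simp add: f_def complex_eq_iff Re)
    then show ?thesis
      using \<psi>0 by (simp add: exp_diff h[symmetric])
  qed
  have add: "f (s + t) = f s + f t" for s t
  proof -
    define D where "D p = f (fst p + snd p) - f (fst p) - f (snd p)" for p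
    have "\<exists>k::int. D p = 2 * pi * k" for p
    proof -
      have "exp (\<i> * of_real (D p)) = \<psi> (fst p + snd p) / \<psi> (fst p) / \<psi> (snd p)"
        by (simp add: D_def \<psi>f exp_diff right_diff_distrib del: add_0_left)
      also have "\<dots> = 1"
        using nz by (simp add: hom)
      finally show ?thesis
        by (auto simp: exp_eq_1 mult.commute mult.left_commute)
    qed
    then have "\<exists>k::int. D p = of_int k * (2 * pi)" for p
      by (metis mult.commute)
    have "D constant_on UNIV"
    proof (rule continuous_discrete_range_constant)
      show "continuous_on UNIV D"
        unfolding D_def by (intro continuous_intros continuous_on_compose2[OF fc]) auto
      fix p :: "'a \<times> 'a"
      show "\<exists>e>0. \<forall>q. q \<in> UNIV \<and> D q \<noteq> D p \<longrightarrow> e \<le> norm (D q - D p)"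
      proof (intro exI[of _ "2 * pi"] conjI allI impI)
        fix q assume "q \<in> UNIV \<and> D q \<noteq> D p"
        moreover obtain k m :: int where "D q = 2 * pi * k" "D p = 2 * pi * m"
          using \<open>\<And>p. \<exists>k::int. D p = 2 * pi * k\<close> by blast
        ultimately have "D q - D p = 2 * pi * of_int (k - m)" "k - m \<noteq> 0"
          by (auto simp: algebra_simps)
        moreover from this have "1 \<le> \<bar>real_of_int (k - m)\<bar>"
          by linarith
        ultimately show "2 * pi \<le> norm (D q - D p)"
          by (simp add: abs_mult)
      qed simp
    qed auto
    then have "D (s, t) = D (0, 0)"
      unfolding constant_on_def by auto
    then show ?thesis
      by (simp add: D_def f_def)
  qed
  have lin: "linear f"
    by (rule continuous_additive_imp_linear[OF fc add])
  define l where "l = (\<Sum>b\<in>Basis. (f b / (2 * pi)) *\<^sub>R b)"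
  have "2 * pi * (l \<bullet> s) = f s" for s
  proof -
    have "2 * pi * (l \<bullet> s) = (\<Sum>b\<in>Basis. (s \<bullet> b) * f b)"
      by (simp add: l_def inner_sum_left sum_distrib_left inner_commute[of s] mult.commute)
    also have "\<dots> = f (\<Sum>b\<in>Basis. (s \<bullet> b) *\<^sub>R b)"
      by (simp add: linear_sum[OF lin] linear_cmul[OF lin])
    finally show ?thesis
      by (simp add: euclidean_representation)
  qed
  then have "\<psi> s = exp (2 * of_real pi * \<i> * of_real (l \<bullet> s))" for s
    by (simp add: \<psi>f mult_ac flip: \<open>\<And>s. 2 * pi * (l \<bullet> s) = f s\<close>)
  then show ?thesis
    by (rule that)
qed

lemma character_sum:
  assumes "\<psi> 0 = (1::complex)" and "\<And>m n :: 'g::ab_group_add. \<psi> (m + n) = \<psi> m * \<psi> n"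
  shows "\<psi> (\<Sum>i\<in>A. g i) = (\<Prod>i\<in>A. \<psi> (g i))"
  by (induction A rule: infinite_finite_induct) (use assms in auto)

text \<open>
  A character of the integer lattice is determined by its values on the standard basis, whose
  arguments supply the coordinates of \<open>l\<close>.
\<close>
lemma lattice_character_exponential:
  fixes \<psi> :: "int ^ 'd \<Rightarrow> complex"
  assumes hom: "\<And>m n. \<psi> (m + n) = \<psi> m * \<psi> n" and unit: "\<And>n. cmod (\<psi> n) = 1"
  obtains l :: "real ^ 'd"
  where "\<And>n. \<psi> n = exp (2 * of_real pi * \<i> * of_real (l \<bullet> (\<chi> i. real_of_int (n $ i))))"
proof -
  have nz: "\<psi> n \<noteq> 0" for n
    using unit[of n] by auto
  have \<psi>0: "\<psi> 0 = 1"
    using hom[of 0 0] nz[of 0] by simp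
  define \<theta> where "\<theta> i = Arg (\<psi> (axis i 1))" for i :: 'd
  have \<theta>: "\<psi> (axis i 1) = exp (\<i> * of_real (\<theta> i))" for i
    using Arg_eq[OF nz, of "axis i 1"] unit by (simp add: \<theta>_def)
  have axis: "\<psi> (axis i k) = exp (of_int k * (\<i> * of_real (\<theta> i)))" for i k
  proof (induction k rule: int_induct[where k = 0])
    case base
    show ?case
      using \<psi>0 by (simp add: axis_def zero_vec_def)
  next
    case (step1 k)
    have "axis i (k + 1) = axis i k + axis i 1"
      by (simp add: axis_def vec_eq_iff)
    then show ?case
      using step1 by (simp add: hom \<theta> exp_add[symmetric] algebra_simps)
  next
    case (step2 k)
    have "axis i k = axis i (k - 1) + axis i 1"
      by (simp add: axis_def vec_eq_iff)
    then have "\<psi> (axis i (k - 1)) = \<psi> (axis i k) / \<psi> (axis i 1)"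
      using nz by (simp add: hom)
    then show ?case
      using step2 by (simp add: \<theta> exp_diff[symmetric] algebra_simps)
  qed
  define l :: "real ^ 'd" where "l = (\<chi> i. \<theta> i / (2 * pi))"
  have "\<psi> n = exp (2 * of_real pi * \<i> * of_real (l \<bullet> (\<chi> i. real_of_int (n $ i))))" for n
  proof -
    have "n = (\<Sum>i\<in>UNIV. axis i (n $ i))"
      by (auto simp: vec_eq_iff axis_def)
    then have "\<psi> n = (\<Prod>i\<in>UNIV. \<psi> (axis i (n $ i)))"
      by (metis character_sum[of \<psi>, OF \<psi>0 hom])
    also have "\<dots> = exp (\<Sum>i\<in>UNIV. of_int (n $ i) * (\<i> * of_real (\<theta> i)))"
      by (simp add: axis exp_sum)
    also have "(\<Sum>i\<in>UNIV. of_int (n $ i) * (\<i> * of_real (\<theta> i)))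
        = 2 * of_real pi * \<i> * of_real (l \<bullet> (\<chi> i. real_of_int (n $ i)))"
      by (simp add: l_def inner_vec_def sum_distrib_left algebra_simps)
    finally show ?thesis .
  qed
  then show ?thesis
    by (rule that)
qed

section \<open>Bounded eigenfunctions\<close>

lemma cmod_exp_character [simp]: "cmod (exp (2 * of_real pi * \<i> * of_real a)) = 1"
  by (simp add: norm_exp_eq_Re)

text \<open>
  Products of two square integrable functions need not be square integrable, so eigenfunctions are
  first replaced by bounded ones. Composing with this map preserves the eigenvalue, because the map
  commutes with rotations of the plane, and it loses no information, because the map is injective.
\<close>
definition squash :: "complex \<Rightarrow> complex" where
  "squash z = z / of_real (1 + cmod z)"

lemma cmod_squash: "cmod (squash z) = cmod z / (1 + cmod z)"
proof -
  have "cmod (of_real (1 + cmod z)) = 1 + cmod z"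
    by (subst norm_of_real) simp
  then show ?thesis
    by (simp only: squash_def norm_divide)
qed

lemma cmod_squash_le_1: "cmod (squash z) \<le> 1"
  unfolding cmod_squash by (subst divide_le_eq_1) (auto intro: add_pos_nonneg)

lemma squash_unit_mult: "cmod u = 1 \<Longrightarrow> squash (u * z) = u * squash z"
  by (simp add: squash_def norm_mult)

lemma squash_eq_iff [simp]: "squash z = squash w \<longleftrightarrow> z = w"
proof
  assume eq: "squash z = squash w"
  have pos: "1 + cmod z > 0" "1 + cmod w > 0"
    by (simp_all add: add_pos_nonneg)
  have "cmod z / (1 + cmod z) = cmod w / (1 + cmod w)"
    using eq by (metis cmod_squash)
  then have "cmod z * (1 + cmod w) = cmod w * (1 + cmod z)"
    using pos by (subst (asm) frac_eq_eq) auto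
  then have "cmod z = cmod w"
    by (simp add: algebra_simps)
  moreover have "complex_of_real (1 + cmod w) \<noteq> 0"
    using pos by (metis less_irrefl of_real_eq_0_iff)
  ultimately show "z = w"
    using eq by (simp add: squash_def)
qed simp

lemma squash_eq_0_iff [simp]: "squash z = 0 \<longleftrightarrow> z = 0"
  using squash_eq_iff[of z 0] by (simp add: squash_def[of 0] del: squash_eq_iff)

lemma borel_measurable_squash [measurable]: "squash \<in> borel_measurable borel"
  unfolding squash_def[abs_def] by measurable

lemma borel_measurable_cnj [measurable (raw)]:
  "f \<in> borel_measurable M \<Longrightarrow> (\<lambda>x. cnj (f x)) \<in> borel_measurable M"
  by (rule borel_measurable_continuous_on) (intro continuous_intros)

lemma cmod_mult_cnj_le_1: "cmod z \<le> 1 \<Longrightarrow> cmod w \<le> 1 \<Longrightarrow> cmod (z * cnj w) \<le> 1"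
  using mult_mono[of "cmod z" 1 "cmod w" 1] by (simp add: norm_mult)

lemma bounded_measurable_in_L2:
  assumes "finite_measure M" and [measurable]: "F \<in> borel_measurable M"
    and bound: "\<And>x. x \<in> space M \<Longrightarrow> cmod (F x) \<le> B"
  shows "F \<in> L2 M"
proof -
  interpret finite_measure M by fact
  have "integrable M (\<lambda>x. (cmod (F x))\<^sup>2)"
    by (rule integrable_const_bound[where B = "B\<^sup>2"]) (auto intro!: power_mono bound)
  then show ?thesis
    by (simp add: L2_def)
qed

lemma L2_eigenfunction_at_squash:
  assumes "prob_space M" and F: "L2_eigenfunction_at M T L l F"
  shows "L2_eigenfunction_at M T L l (\<lambda>x. squash (F x))"
proof -
  interpret prob_space M by fact
  have [measurable]: "F \<in> borel_measurable M"
    using F by (simp add: L2_eigenfunction_at_def L2_def)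
  have "(\<lambda>x. squash (F x)) \<in> L2 M"
    by (rule bounded_measurable_in_L2[OF finite_measure_axioms _ cmod_squash_le_1]) measurable
  moreover have "AE x in M. squash (F (T t x)) = exp (2 * of_real pi * \<i> * of_real (l \<bullet> t)) * squash (F x)"
    if "t \<in> L" for t
  proof -
    have "AE x in M. F (T t x) = exp (2 * of_real pi * \<i> * of_real (l \<bullet> t)) * F x"
      using F that by (simp add: L2_eigenfunction_at_def)
    then show ?thesis
      by eventually_elim (simp add: squash_unit_mult)
  qed
  ultimately show ?thesis
    using F by (simp add: L2_eigenfunction_at_def)
qed

lemma ae_constant_squash: "ae_constant M (\<lambda>x. squash (F x)) \<Longrightarrow> prob_space M \<Longrightarrow> ae_constant M F"
proof -
  assume "ae_constant M (\<lambda>x. squash (F x))" "prob_space M"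
  then interpret prob_space M by simp
  obtain c where c: "AE x in M. squash (F x) = c"
    using \<open>ae_constant _ _\<close> by (auto simp: ae_constant_def)
  then obtain z where "squash z = c"
    using eventually_happens'[OF ae_filter_bot c] by blast
  with c show ?thesis
    unfolding ae_constant_def by (intro exI[of _ z]) auto
qed

section \<open>Constant autocorrelations\<close>

lemma measure_preserving_AE:
  assumes T: "T \<in> M \<rightarrow>\<^sub>M M" "distr M M T = M" and P: "AE x in M. P x"
  shows "AE x in M. P (T x)"
  by (rule AE_distrD[OF T(1)]) (simp only: T(2) P)

lemma measure_preserving_actionD:
  assumes "measure_preserving_action M T"
  shows "T g \<in> M \<rightarrow>\<^sub>M M" and "distr M M (T g) = M"
    and "x \<in> space M \<Longrightarrow> T 0 x = x"
    and "x \<in> space M \<Longrightarrow> T (g + h) x = T g (T h x)"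
    and "x \<in> space M \<Longrightarrow> T g (T h x) = T h (T g x)"
proof -
  show comp: "T (g + h) x = T g (T h x)" if "x \<in> space M" for x g h
    using assms that by (simp add: measure_preserving_action_def)
  show "T g (T h x) = T h (T g x)" if "x \<in> space M"
    using comp[OF that, of g h] comp[OF that, of h g] by (simp add: add.commute)
qed (use assms in \<open>auto simp: measure_preserving_action_def\<close>)

text \<open>
  The case \<open>g = 0\<close> shows that \<open>F\<close> has constant modulus \<open>r > 0\<close>. Hence the products
  \<open>F (T g x) * cnj (F x)\<close> being constant means that \<open>F\<close> composed with \<open>T g\<close> is a multiple of \<open>F\<close>.
  The factors inherit multiplicativity from the action, as \<open>F\<close> vanishes almost nowhere.
\<close>
lemma constant_autocorrelations_imp_eigenfunction:
  fixes T :: "'g::ab_group_add \<Rightarrow> 'a \<Rightarrow> 'a" and F :: "'a \<Rightarrow> complex"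
  assumes "prob_space M" and T: "measure_preserving_action M T"
    and const: "\<And>g. \<exists>c. AE x in M. F (T g x) * cnj (F x) = c"
    and nonzero: "\<not> (AE x in M. F x = 0)"
  obtains \<psi> and r :: real
  where "\<And>g h. \<psi> (g + h) = \<psi> g * \<psi> h" "\<And>g. cmod (\<psi> g) = 1"
    "\<And>g. AE x in M. F (T g x) = \<psi> g * F x" "r > 0" "AE x in M. cmod (F x) = r"
proof -
  interpret prob_space M by fact
  note T = measure_preserving_actionD[OF T]
  obtain c where c: "\<And>g. AE x in M. F (T g x) * cnj (F x) = c g"
    using const by metis
  define r where "r = sqrt (cmod (c 0))"
  have F: "AE x in M. cmod (F x) = r"
    using c[of 0] AE_space
  proof eventually_elim
    case (elim x)
    then have "(cmod (F x))\<^sup>2 = cmod (c 0)"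
      by (simp add: T(3) norm_mult power2_eq_square flip: elim(1))
    then show ?case
      by (simp add: r_def real_sqrt_unique)
  qed
  have "r \<noteq> 0"
  proof
    assume "r = 0"
    with F have "AE x in M. F x = 0"
      by simp
    with nonzero show False ..
  qed
  then have r: "r > 0"
    by (simp add: r_def)
  define \<psi> where "\<psi> g = c g / of_real (r\<^sup>2)" for g
  have eigen: "AE x in M. F (T g x) = \<psi> g * F x" for g
    using c[of g] F
  proof eventually_elim
    case (elim x)
    have "cnj (F x) * F x = of_real (r\<^sup>2)"
      using elim complex_norm_square[of "F x"] by (simp add: mult.commute)
    then show ?case
      using r by (simp add: \<psi>_def elim(1)[symmetric] mult.assoc)
  qed
  show ?thesis
  proof (rule that[OF _ _ eigen r F])
    fix g h
    have "AE x in M. cmod (\<psi> g) = 1"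
      using eigen[of g] F measure_preserving_AE[OF T(1,2) F, of g]
      by eventually_elim (use r in \<open>auto simp: norm_mult\<close>)
    then show "cmod (\<psi> g) = 1"
      by simp
    have "AE x in M. \<psi> (g + h) = \<psi> g * \<psi> h"
      using eigen[of "g + h"] eigen[of h] measure_preserving_AE[OF T(1,2) eigen[of g], of h] F AE_space
    proof eventually_elim
      case (elim x)
      then have "\<psi> (g + h) * F x = (\<psi> g * \<psi> h) * F x" "F x \<noteq> 0"
        using r by (auto simp: T(4))
      then show ?case
        by simp
    qed
    then show "\<psi> (g + h) = \<psi> g * \<psi> h"
      by simp
  qed
qed

section \<open>Actions of Euclidean space\<close>

text \<open>
  Changing a function on a null set of the product makes it measurable for the uncompleted product;
  by Fubini almost every section is changed only on a null set.
\<close>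
lemma completion_measurable_sections:
  fixes K :: "'b \<times> 'a \<Rightarrow> complex"
  assumes "sigma_finite_measure N" "sigma_finite_measure M"
    and K: "K \<in> borel_measurable (completion (N \<Otimes>\<^sub>M M))"
  obtains K' where "K' \<in> borel_measurable (N \<Otimes>\<^sub>M M)" "AE s in N. AE x in M. K (s, x) = K' (s, x)"
proof -
  interpret M: sigma_finite_measure M by fact
  interpret N: sigma_finite_measure N by fact
  interpret pair_sigma_finite N M ..
  have Re: "(\<lambda>p. Re (K p)) \<in> borel_measurable (completion (N \<Otimes>\<^sub>M M))"
    and Im: "(\<lambda>p. Im (K p)) \<in> borel_measurable (completion (N \<Otimes>\<^sub>M M))"
    using K by (auto intro: borel_measurable_Re borel_measurable_Im)
  obtain A where [measurable]: "A \<in> borel_measurable (N \<Otimes>\<^sub>M M)"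
    and A: "AE p in N \<Otimes>\<^sub>M M. Re (K p) = A p"
    using completion_ex_borel_measurable_real[OF Re] by blast
  obtain B where [measurable]: "B \<in> borel_measurable (N \<Otimes>\<^sub>M M)"
    and B: "AE p in N \<Otimes>\<^sub>M M. Im (K p) = B p"
    using completion_ex_borel_measurable_real[OF Im] by blast
  define K' where "K' p = of_real (A p) + \<i> * of_real (B p)" for p
  have "K' \<in> borel_measurable (N \<Otimes>\<^sub>M M)"
    unfolding K'_def[abs_def] by measurable
  moreover have "AE p in N \<Otimes>\<^sub>M M. K p = K' p"
    using A B by eventually_elim (simp add: K'_def complex_eq_iff)
  then have "AE s in N. AE x in M. K (s, x) = K' (s, x)"
    by (rule AE_pair)
  ultimately show ?thesis
    by (rule that)
qed

text \<open>
  For almost every \<open>s\<close> the constant \<open>c s\<close> is the space integral of a jointly measurable function.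
  This is where joint measurability of the action enters; it is what makes the character of an
  eigenfunction measurable, and thereby continuous.
\<close>
lemma autocorrelation_measurable_in_time:
  assumes "prob_space M" and T: "Rd_action M T" and [measurable]: "F \<in> borel_measurable M"
    and c: "\<And>s. AE x in M. F (T s x) * cnj (F x) = c s"
  obtains f where "f \<in> borel_measurable borel" "AE s in lborel. c s = f s"
proof -
  interpret prob_space M by fact
  define K where "K p = F (T (fst p) (snd p)) * cnj (F (snd p))" for p
  have T': "(\<lambda>p. T (fst p) (snd p)) \<in> completion (lborel \<Otimes>\<^sub>M M) \<rightarrow>\<^sub>M M"
    using T by (simp add: Rd_action_def case_prod_beta')
  have snd: "snd \<in> completion (lborel \<Otimes>\<^sub>M M) \<rightarrow>\<^sub>M M"
    by (intro measurable_completion) measurable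
  have "K \<in> borel_measurable (completion (lborel \<Otimes>\<^sub>M M))"
    unfolding K_def[abs_def]
    by (intro borel_measurable_times borel_measurable_cnj measurable_compose[OF T'] measurable_compose[OF snd])
       measurable
  from completion_measurable_sections[OF sigma_finite_lborel sigma_finite_measure_axioms this]
  obtain K' where [measurable]: "K' \<in> borel_measurable (lborel \<Otimes>\<^sub>M M)"
    and K': "AE s in lborel. AE x in M. K (s, x) = K' (s, x)" .
  have "(\<lambda>s. \<integral>x. K' (s, x) \<partial>M) \<in> borel_measurable lborel"
    by measurable
  moreover have "AE s in lborel. c s = (\<integral>x. K' (s, x) \<partial>M)"
    using K'
  proof eventually_elim
    case (elim s)
    then have "AE x in M. K' (s, x) = c s"
      using c[of s] by eventually_elim (simp add: K_def)
    then have "(\<integral>x. K' (s, x) \<partial>M) = (\<integral>x. c s \<partial>M)"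
      by (intro integral_cong_AE) measurable
    then show ?case
      by (simp add: prob_space)
  qed
  ultimately show ?thesis
    by (intro that) simp_all
qed

text \<open>
  Let \<open>G\<close> be a bounded eigenfunction in the direction \<open>L\<close>. As the group is abelian, \<open>G\<close> composed with
  \<open>T s\<close> is one with the same eigenvalue, so the eigenvalues cancel in \<open>G (T s x) * cnj (G x)\<close>. This
  product is thus invariant in the direction \<open>L\<close>, and constant by ergodicity in that direction. Hence
  \<open>G\<close> is an eigenfunction of the whole action, and weak mixing makes it constant.
\<close>
lemma Rd_weak_mixing_along_if_ergodic:
  fixes T :: "real ^ 'd \<Rightarrow> 'a \<Rightarrow> 'a"
  assumes "prob_space M" and T: "Rd_action M T" and mixing: "Rd_weak_mixing_along M T UNIV"
    and ergodic: "Rd_ergodic_along M T L"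
  shows "Rd_weak_mixing_along M T L"
  unfolding Rd_weak_mixing_along_def
proof (intro allI impI)
  fix F assume "L2_eigenfunction M T L F"
  then obtain l where F: "L2_eigenfunction_at M T L l F"
    by (auto simp: L2_eigenfunction_def)
  interpret prob_space M by fact
  have act: "measure_preserving_action M T"
    using T by (simp add: Rd_action_def)
  note act' = measure_preserving_actionD[OF act]
  define G where "G x = squash (F x)" for x
  define e where "e t = exp (2 * of_real pi * \<i> * of_real (l \<bullet> t))" for t
  have e: "e t * cnj (e t) = 1" for t
    by (simp add: complex_norm_square[symmetric] e_def)
  have G: "L2_eigenfunction_at M T L l G"
    using L2_eigenfunction_at_squash[OF \<open>prob_space M\<close> F] by (simp add: G_def[abs_def])
  have [measurable]: "G \<in> borel_measurable M" and nz: "\<not> (AE x in M. G x = 0)"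
    and eig: "\<And>t. t \<in> L \<Longrightarrow> AE x in M. G (T t x) = e t * G x"
    using G by (auto simp: L2_eigenfunction_at_def L2_def e_def)
  have bound: "cmod (G x) \<le> 1" for x
    by (simp add: G_def cmod_squash_le_1)
  have const: "\<exists>c. AE x in M. G (T s x) * cnj (G x) = c" for s
  proof -
    define H where "H x = G (T s x) * cnj (G x)" for x
    have [measurable]: "T s \<in> M \<rightarrow>\<^sub>M M"
      by (rule act')
    have "H \<in> borel_measurable M"
      unfolding H_def[abs_def] by measurable
    moreover have "cmod (H x) \<le> 1" for x
      unfolding H_def by (intro cmod_mult_cnj_le_1 bound)
    ultimately have L2: "H \<in> L2 M"
      by (intro bounded_measurable_in_L2[OF finite_measure_axioms])
    have "AE x in M. H (T t x) = H x" if t: "t \<in> L" for t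
      using eig[OF t] measure_preserving_AE[OF act'(1,2) eig[OF t], of s] AE_space
    proof eventually_elim
      case (elim x)
      then have "H (T t x) = (e t * cnj (e t)) * H x"
        by (simp add: H_def act'(5)[of x s t] mult_ac)
      then show ?case
        by (simp add: e)
    qed
    then have "AE x in M. H x = 0 \<or> ae_constant M H"
      using L2 ergodic by (auto simp: Rd_ergodic_along_def L2_invariant_def L2_eigenfunction_at_def)
    then have "ae_constant M H"
      by (cases "ae_constant M H") (auto simp: ae_constant_def)
    then show ?thesis
      by (simp add: ae_constant_def H_def)
  qed
  obtain \<psi> and r :: real where hom: "\<And>s t. \<psi> (s + t) = \<psi> s * \<psi> t" and unit: "\<And>s. cmod (\<psi> s) = 1"
    and \<psi>: "\<And>s. AE x in M. G (T s x) = \<psi> s * G x" and r: "r > 0" and Gr: "AE x in M. cmod (G x) = r"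
    by (rule constant_autocorrelations_imp_eigenfunction[OF \<open>prob_space M\<close> act const nz]) (rule that)
  have "AE x in M. G (T s x) * cnj (G x) = \<psi> s * of_real (r\<^sup>2)" for s
    using \<psi>[of s] Gr
    by eventually_elim (simp add: complex_norm_square[symmetric] mult.assoc)
  from autocorrelation_measurable_in_time[OF \<open>prob_space M\<close> T \<open>G \<in> borel_measurable M\<close> this]
  obtain f where [measurable]: "f \<in> borel_measurable borel"
    and f: "AE s in lborel. \<psi> s * of_real (r\<^sup>2) = f s"
    by blast
  have "continuous_on UNIV \<psi>"
  proof (rule measurable_character_continuous[OF hom unit])
    show "(\<lambda>s. f s / of_real (r\<^sup>2)) \<in> borel_measurable borel"
      by measurable
    show "AE s in lborel. \<psi> s = f s / of_real (r\<^sup>2)"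
      using f by eventually_elim (use r in \<open>auto simp: field_simps\<close>)
  qed
  then obtain l' where "\<And>s. \<psi> s = exp (2 * of_real pi * \<i> * of_real (l' \<bullet> s))"
    using continuous_character_exponential[OF hom unit] by metis
  then have "L2_eigenfunction M T UNIV G"
    using \<psi> G by (auto simp: L2_eigenfunction_def L2_eigenfunction_at_def)
  then have "ae_constant M (\<lambda>x. squash (F x))"
    using mixing by (auto simp: Rd_weak_mixing_along_def G_def[abs_def])
  then show "ae_constant M F"
    using \<open>prob_space M\<close> by (rule ae_constant_squash)
qed

lemma Rd_ergodic_along_if_weak_mixing:
  "0 \<in> L \<Longrightarrow> Rd_weak_mixing_along M T L \<Longrightarrow> Rd_ergodic_along M T L"
  by (auto simp: Rd_ergodic_along_def Rd_weak_mixing_along_def L2_invariant_def L2_eigenfunction_def)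

section \<open>The suspension of a lattice action\<close>

lemma finite_measure_cube_measure: "finite_measure (cube_measure :: (real ^ 'd) measure)"
proof (rule finite_measureI)
  have sets: "(unit_cube :: (real ^ 'd) set) \<in> sets lborel"
    unfolding unit_cube_def by measurable
  have "emeasure lborel (unit_cube :: (real ^ 'd) set) \<le> emeasure lborel (cbox 0 1 :: (real ^ 'd) set)"
    by (intro emeasure_mono) (auto simp: unit_cube_def mem_box_cart less_imp_le)
  also have "\<dots> < \<infinity>"
    by (intro emeasure_bounded_finite bounded_cbox)
  finally have "emeasure lborel (unit_cube :: (real ^ 'd) set) \<noteq> \<infinity>"
    by simp
  then show "emeasure cube_measure (space (cube_measure :: (real ^ 'd) measure)) \<noteq> \<infinity>"
    using sets by (simp add: cube_measure_def space_restrict_space emeasure_restrict_space)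
qed

lemma space_cube_measure: "space cube_measure = unit_cube"
  by (simp add: cube_measure_def space_restrict_space)

lemma AE_pair_swap:
  assumes "sigma_finite_measure M" "sigma_finite_measure N" and Q: "AE p in M \<Otimes>\<^sub>M N. Q p"
  shows "AE y in N. AE x in M. Q (x, y)"
proof -
  interpret M: sigma_finite_measure M by fact
  interpret N: sigma_finite_measure N by fact
  interpret P: pair_sigma_finite M N ..
  interpret P': pair_sigma_finite N M ..
  have "AE p in distr (N \<Otimes>\<^sub>M M) (M \<Otimes>\<^sub>M N) (\<lambda>(x, y). (y, x)). Q p"
    using Q by (subst (asm) P.distr_pair_swap)
  from AE_distrD[OF measurable_pair_swap' this]
  show ?thesis
    by (intro P'.AE_pair[of "\<lambda>p. Q (snd p, fst p)", simplified]) (simp add: case_prod_beta')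
qed

lemma distr_pair_snd:
  assumes "prob_space M" and "sigma_finite_measure N"
  shows "distr (M \<Otimes>\<^sub>M N) N snd = N"
proof (rule measure_eqI)
  interpret M: prob_space M by fact
  interpret N: sigma_finite_measure N by fact
  fix A assume "A \<in> sets (distr (M \<Otimes>\<^sub>M N) N snd)"
  then have A: "A \<in> sets N"
    by simp
  then have "snd -` A \<inter> space (M \<Otimes>\<^sub>M N) = space M \<times> A"
    by (auto simp: space_pair_measure dest: sets.sets_into_space)
  then show "emeasure (distr (M \<Otimes>\<^sub>M N) N snd) A = emeasure N A"
    using A by (simp add: emeasure_distr N.emeasure_pair_measure_Times M.emeasure_space_1)
qed simp

lemma suspension_apply:
  "suspension T t (x, r) = (T (\<chi> i. \<lfloor>(t + r) $ i\<rfloor>) x, \<chi> i. frac ((t + r) $ i))"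
  by (simp add: suspension_def)

lemma frac_vec_in_unit_cube: "(\<chi> i. frac (t $ i)) \<in> unit_cube"
  by (simp add: unit_cube_def frac_lt_1)

text \<open>
  The fibre average \<open>h\<close> of \<open>H\<close> is its conditional expectation given the cube coordinate, that is,
  its orthogonal projection to the cube functions. As each \<open>S k\<close> preserves \<open>M\<close>, the function
  \<open>h\<close> is invariant in the direction \<open>L\<close> too. So \<open>H - h\<close> is invariant and orthogonal to the cube
  functions, and ergodicity in the direction \<open>L\<close> forces it to vanish.
\<close>
lemma bounded_invariant_fibrewise_constant:
  fixes M :: "'a measure" and S :: "int ^ 'd \<Rightarrow> 'a \<Rightarrow> 'a" and H :: "'a \<times> (real ^ 'd) \<Rightarrow> complex"
  assumes "prob_space M" and act: "measure_preserving_action M S"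
    and ergodic: "Zd_ergodic_along M S L"
    and H: "H \<in> borel_measurable (suspension_measure M)" and bound: "\<And>y. cmod (H y) \<le> 1"
    and inv: "\<And>t. t \<in> L \<Longrightarrow> AE y in suspension_measure M. H (suspension S t y) = H y"
  shows "AE y in suspension_measure M. H y = (\<integral>x. H (x, snd y) \<partial>M)"
proof -
  interpret prob_space M by fact
  interpret C: finite_measure "cube_measure :: (real ^ 'd) measure"
    by (rule finite_measure_cube_measure)
  interpret P: pair_sigma_finite M "cube_measure :: (real ^ 'd) measure" ..
  interpret MC: finite_measure "suspension_measure M :: ('a \<times> (real ^ 'd)) measure"
    unfolding suspension_measure_def
    by (rule finite_measure_pair_measure[OF C.finite_measure_axioms finite_measure_axioms])
  have [measurable]: "H \<in> borel_measurable (M \<Otimes>\<^sub>M cube_measure)"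
    using H by (simp add: suspension_measure_def)
  note act' = measure_preserving_actionD[OF act]
  note snd = distr_pair_snd[OF \<open>prob_space M\<close> C.sigma_finite_measure_axioms]
  define h where "h r = (\<integral>x. H (x, r) \<partial>M)" for r
  have hm[measurable]: "h \<in> borel_measurable cube_measure"
    unfolding h_def[abs_def] by measurable
  have sec: "integrable M (\<lambda>x. H (x, r))" if [measurable]: "r \<in> space cube_measure" for r
    by (rule integrable_const_bound[where B = 1]) (auto simp: bound)
  have hb: "cmod (h r) \<le> 1" if "r \<in> space cube_measure" for r
  proof -
    have "cmod (h r) \<le> (\<integral>x. cmod (H (x, r)) \<partial>M)"
      unfolding h_def by (rule integral_norm_bound)
    also have "\<dots> \<le> (\<integral>x. 1 \<partial>M)"
      by (intro integral_mono integrable_norm sec that) (auto simp: bound)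
    finally show ?thesis
      by (simp add: prob_space)
  qed
  define K where "K y = H y - h (snd y)" for y
  have [measurable]: "K \<in> borel_measurable (M \<Otimes>\<^sub>M cube_measure)"
    unfolding K_def[abs_def] by measurable
  have Km: "K \<in> borel_measurable (suspension_measure M)"
    by (simp add: suspension_measure_def)
  have Kb: "cmod (K y) \<le> 2" if "y \<in> space (suspension_measure M)" for y
    using that norm_triangle_ineq4[of "H y" "h (snd y)"] bound[of y] hb[of "snd y"]
    by (auto simp: K_def suspension_measure_def space_pair_measure)
  have "K \<in> L2 (suspension_measure M)"
    by (rule bounded_measurable_in_L2[OF MC.finite_measure_axioms Km Kb])
  moreover have "(\<integral>y. K y * cnj (f (snd y)) \<partial>suspension_measure M) = 0" if f: "f \<in> L2 cube_measure" for f
  proof -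
    have [measurable]: "f \<in> borel_measurable cube_measure"
      and f2: "integrable cube_measure (\<lambda>r. (cmod (f r))\<^sup>2)"
      using f by (auto simp: L2_def)
    have "integrable cube_measure f"
    proof (rule Bochner_Integration.integrable_bound)
      show "integrable cube_measure (\<lambda>r. 1 + (cmod (f r))\<^sup>2)"
        using f2 by simp
      show "AE r in cube_measure. cmod (f r) \<le> norm (1 + (cmod (f r))\<^sup>2)"
      proof (intro always_eventually allI)
        fix r show "cmod (f r) \<le> norm (1 + (cmod (f r))\<^sup>2)"
          using sum_squares_bound[of 1 "cmod (f r)"] norm_ge_zero[of "f r"]
          unfolding real_norm_def power_one mult_1_right by linarith
      qed
    qed measurable
    then have "integrable (M \<Otimes>\<^sub>M cube_measure) (\<lambda>p. f (snd p))"
      by (subst integrable_distr_eq[symmetric, where N = cube_measure]) (simp_all add: snd)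
    then have "integrable (M \<Otimes>\<^sub>M cube_measure) (\<lambda>y. 2 * cmod (f (snd y)))"
      by simp
    then have int: "integrable (M \<Otimes>\<^sub>M cube_measure) (\<lambda>(x, r). K (x, r) * cnj (f r))"
    proof (rule Bochner_Integration.integrable_bound)
      show "AE y in M \<Otimes>\<^sub>M cube_measure. norm (case y of (x, r) \<Rightarrow> K (x, r) * cnj (f r)) \<le> norm (2 * cmod (f (snd y)))"
        using AE_space
        by eventually_elim
           (use Kb in \<open>auto simp: norm_mult suspension_measure_def space_pair_measure intro!: mult_right_mono\<close>)
    qed measurable
    have "(\<integral>y. K y * cnj (f (snd y)) \<partial>suspension_measure M)
        = (\<integral>r. (\<integral>x. K (x, r) * cnj (f r) \<partial>M) \<partial>cube_measure)"
      using P.integral_snd[OF int] by (simp add: suspension_measure_def case_prod_beta')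
    also have "\<dots> = (\<integral>r. 0 \<partial>(cube_measure :: (real ^ 'd) measure))"
    proof (rule Bochner_Integration.integral_cong[OF refl])
      fix r :: "real ^ 'd" assume "r \<in> space cube_measure"
      from sec[OF this] show "(\<integral>x. K (x, r) * cnj (f r) \<partial>M) = 0"
        by (simp add: K_def prob_space h_def)
    qed
    finally show ?thesis
      by simp
  qed
  then have "\<forall>F\<in>cube_functions. (\<integral>y. K y * cnj (F y) \<partial>suspension_measure M) = 0"
    by (auto simp: cube_functions_def case_prod_beta')
  ultimately have perp: "K \<in> L2_cube_perp M"
    by (simp add: L2_cube_perp_def)
  have "AE y in suspension_measure M. K (suspension S t y) = K y" if t: "t \<in> L" for t
  proof -
    define q where "q r = (\<chi> i. frac ((t + r) $ i))" for r :: "real ^ 'd"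
    have q: "q r \<in> space cube_measure" for r
      unfolding space_cube_measure q_def by (rule frac_vec_in_unit_cube)
    have "AE r in cube_measure. AE x in M. H (suspension S t (x, r)) = H (x, r)"
      using inv[OF t] unfolding suspension_measure_def
      by (rule AE_pair_swap[OF sigma_finite_measure_axioms C.sigma_finite_measure_axioms])
    then have "AE r in cube_measure. h (q r) = h r"
      using AE_space
    proof eventually_elim
      case (elim r)
      define k :: "int ^ 'd" where "k = (\<chi> i. \<lfloor>(t + r) $ i\<rfloor>)"
      have [measurable]: "(\<lambda>x. H (x, q r)) \<in> borel_measurable M" "(\<lambda>x. H (x, r)) \<in> borel_measurable M"
        using q elim(2) by measurable
      have [measurable]: "S k \<in> M \<rightarrow>\<^sub>M M"
        by (rule act')
      \<comment> \<open>Moving \<open>(x, r)\<close> by \<open>t\<close> applies \<open>S k\<close> to \<open>x\<close>, with \<open>k\<close> depending on \<open>r\<close> only.\<close>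
      have "h (q r) = (\<integral>x. H (x, q r) \<partial>distr M M (S k))"
        by (simp add: h_def act')
      also have "\<dots> = (\<integral>x. H (S k x, q r) \<partial>M)"
        by (rule integral_distr) measurable
      also have "\<dots> = h r"
        unfolding h_def
      proof (rule integral_cong_AE)
        show "AE x in M. H (S k x, q r) = H (x, r)"
          using elim(1) by (simp add: suspension_apply k_def q_def)
      qed measurable
      finally show ?case .
    qed
    then have "AE y in suspension_measure M. h (q (snd y)) = h (snd y)"
      unfolding suspension_measure_def by (intro AE_distrD[OF measurable_snd]) (simp only: snd)
    with inv[OF t] show ?thesis
      by eventually_elim (auto simp: K_def suspension_def q_def split: prod.splits)
  qed
  then have "AE y in suspension_measure M. K y = 0"
    using ergodic perp by (auto simp: Zd_ergodic_along_def L2_invariant_def L2_eigenfunction_at_def L2_cube_perp_def)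
  then show ?thesis
    by eventually_elim (simp add: K_def h_def)
qed

text \<open>
  Such an \<open>F\<close> is almost everywhere equal to the cube function of its fibre averages, to which it
  is also orthogonal; so its norm is zero.
\<close>
lemma perp_fibrewise_constant_imp_zero:
  fixes F :: "'a \<times> (real ^ 'd) \<Rightarrow> complex"
  assumes "prob_space M" and F: "F \<in> L2_cube_perp M"
    and const: "AE r in cube_measure. ae_constant M (\<lambda>x. F (x, r))"
  shows "AE y in suspension_measure M. F y = 0"
proof -
  interpret prob_space M by fact
  interpret C: finite_measure "cube_measure :: (real ^ 'd) measure"
    by (rule finite_measure_cube_measure)
  interpret P: pair_sigma_finite M "cube_measure :: (real ^ 'd) measure" ..
  have [measurable]: "F \<in> borel_measurable (M \<Otimes>\<^sub>M cube_measure)"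
    and F2: "integrable (M \<Otimes>\<^sub>M cube_measure) (\<lambda>y. (cmod (F y))\<^sup>2)"
    and perp: "\<And>f. f \<in> L2 cube_measure \<Longrightarrow> (\<integral>y. F y * cnj (f (snd y)) \<partial>(M \<Otimes>\<^sub>M cube_measure)) = 0"
    using F by (auto simp: L2_cube_perp_def L2_def suspension_measure_def cube_functions_def case_prod_beta')
  define f where "f r = (\<integral>x. F (x, r) \<partial>M)" for r
  have [measurable]: "f \<in> borel_measurable cube_measure"
    unfolding f_def[abs_def] by measurable
  have sec: "AE r in cube_measure. (\<lambda>x. F (x, r)) \<in> borel_measurable M"
    using AE_space by eventually_elim measurable
  have Ff: "AE r in cube_measure. AE x in M. F (x, r) = f r"
    using const sec
  proof eventually_elim
    case (elim r)
    note [measurable] = elim(2)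
    obtain c where c: "AE x in M. F (x, r) = c"
      using elim by (auto simp: ae_constant_def)
    then have "f r = (\<integral>x. c \<partial>M)"
      unfolding f_def by (intro integral_cong_AE) measurable
    with c show ?case
      by (simp add: prob_space)
  qed
  \<comment> \<open>Orthogonality may be tested against \<open>f\<close> only if \<open>f\<close> is square integrable; it inherits this from \<open>F\<close>.\<close>
  have "integrable cube_measure (\<lambda>r. \<integral>x. (cmod (F (x, r)))\<^sup>2 \<partial>M)"
    using F2 by (intro P.integrable_snd) (simp add: case_prod_beta')
  moreover have "AE r in cube_measure. (\<integral>x. (cmod (F (x, r)))\<^sup>2 \<partial>M) = (cmod (f r))\<^sup>2"
    using Ff sec
  proof eventually_elim
    case (elim r)
    note [measurable] = elim(2)
    have "(\<integral>x. (cmod (F (x, r)))\<^sup>2 \<partial>M) = (\<integral>x. (cmod (f r))\<^sup>2 \<partial>M)"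
      using elim(1) by (intro integral_cong_AE) auto
    then show ?case
      by (simp add: prob_space)
  qed
  ultimately have "integrable cube_measure (\<lambda>r. (cmod (f r))\<^sup>2)"
    by (subst (asm) integrable_cong_AE[where g = "\<lambda>r. (cmod (f r))\<^sup>2"]) auto
  then have f: "f \<in> L2 cube_measure"
    by (simp add: L2_def)
  have "AE x in M. AE r in cube_measure. F (x, r) = f r"
    using Ff by (subst P.AE_commute) measurable
  then have Ff': "AE y in M \<Otimes>\<^sub>M cube_measure. F y = f (snd y)"
    by (intro P.AE_pair_measure) (auto simp: case_prod_beta')
  have "0 = (\<integral>y. F y * cnj (f (snd y)) \<partial>(M \<Otimes>\<^sub>M cube_measure))"
    using perp[OF f] by simp
  also have "\<dots> = (\<integral>y. of_real ((cmod (F y))\<^sup>2) \<partial>(M \<Otimes>\<^sub>M cube_measure))"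
    by (intro integral_cong_AE) (use Ff' in \<open>auto simp del: of_real_power simp: complex_norm_square elim!: eventually_mono\<close>)
  also have "\<dots> = of_real (\<integral>y. (cmod (F y))\<^sup>2 \<partial>(M \<Otimes>\<^sub>M cube_measure))"
    by (rule integral_complex_of_real)
  finally have "(\<integral>y. (cmod (F y))\<^sup>2 \<partial>(M \<Otimes>\<^sub>M cube_measure)) = 0"
    by (metis of_real_eq_0_iff)
  then show ?thesis
    unfolding suspension_measure_def using integral_nonneg_eq_0_iff_AE[OF F2] by simp
qed

section \<open>Lattice actions\<close>

text \<open>
  When \<open>N\<close> is the cube measure, this map is the suspension flow at the integer time \<open>n\<close>, which
  leaves the cube coordinate alone.
\<close>
lemma distr_lattice_shift:
  assumes "prob_space M" and act: "measure_preserving_action M S" and "sigma_finite_measure N"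
  shows "(\<lambda>(x, r). (S n x, r)) \<in> M \<Otimes>\<^sub>M N \<rightarrow>\<^sub>M M \<Otimes>\<^sub>M N"
    and "distr (M \<Otimes>\<^sub>M N) (M \<Otimes>\<^sub>M N) (\<lambda>(x, r). (S n x, r)) = M \<Otimes>\<^sub>M N"
proof -
  note act' = measure_preserving_actionD[OF act]
  have [measurable]: "S n \<in> M \<rightarrow>\<^sub>M M"
    by (rule act')
  show "(\<lambda>(x, r). (S n x, r)) \<in> M \<Otimes>\<^sub>M N \<rightarrow>\<^sub>M M \<Otimes>\<^sub>M N"
    by measurable
  have N: "distr N N (\<lambda>r. r) = N"
    by (rule distr_id2) simp
  show "distr (M \<Otimes>\<^sub>M N) (M \<Otimes>\<^sub>M N) (\<lambda>(x, r). (S n x, r)) = M \<Otimes>\<^sub>M N"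
    using pair_measure_distr[of "S n" M M "\<lambda>r. r" N N] assms(3) by (simp add: act' N)
qed

text \<open>
  Every character of the lattice is an exponential, so a function with constant autocorrelations is
  null or an eigenfunction in the sense of weak mixing.
\<close>
lemma Zd_constant_if_autocorrelations_constant:
  fixes S :: "int ^ 'd \<Rightarrow> 'a \<Rightarrow> 'a"
  assumes "prob_space M" and act: "measure_preserving_action M S" and mixing: "Zd_weak_mixing M S"
    and G: "G \<in> L2 M" and const: "\<And>n. \<exists>c. AE x in M. G (S n x) * cnj (G x) = c"
  shows "ae_constant M G"
proof (cases "AE x in M. G x = 0")
  case True
  then show ?thesis
    by (auto simp: ae_constant_def)
next
  case False
  obtain \<psi> and r :: real where hom: "\<And>m n. \<psi> (m + n) = \<psi> m * \<psi> n" and unit: "\<And>n. cmod (\<psi> n) = 1"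
    and \<psi>: "\<And>n. AE x in M. G (S n x) = \<psi> n * G x"
    by (rule constant_autocorrelations_imp_eigenfunction[OF \<open>prob_space M\<close> act const False]) (rule that)
  obtain l :: "real ^ 'd"
    where "\<And>n. \<psi> n = exp (2 * of_real pi * \<i> * of_real (l \<bullet> (\<chi> i. real_of_int (n $ i))))"
    using lattice_character_exponential[OF hom unit] by metis
  with \<psi> G mixing False show ?thesis
    unfolding Zd_weak_mixing_def by metis
qed

text \<open>
  The argument of the continuous case with integer times only. For a bounded eigenfunction \<open>G\<close> in the
  direction \<open>L\<close>, the products \<open>G (S n x, r) * cnj (G (x, r))\<close> are invariant in that direction, hence
  depend on \<open>r\<close> alone. For almost every fixed \<open>r\<close> the function \<open>\<lambda>x. G (x, r)\<close> therefore has
  constant autocorrelations under \<open>S\<close>, and weak mixing of \<open>S\<close> makes it constant. Consequently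
  the eigenfunction \<open>F\<close>, of which \<open>G\<close> is an injective image, is constant on almost all fibres;
  being orthogonal to the cube functions it would be zero.
\<close>
lemma Zd_weak_mixing_along_if_ergodic:
  fixes M :: "'a measure" and S :: "int ^ 'd \<Rightarrow> 'a \<Rightarrow> 'a"
  assumes "prob_space M" and act: "measure_preserving_action M S" and mixing: "Zd_weak_mixing M S"
    and ergodic: "Zd_ergodic_along M S L"
  shows "Zd_weak_mixing_along M S L"
  unfolding Zd_weak_mixing_along_def
proof
  assume "\<exists>F\<in>L2_cube_perp M. L2_eigenfunction (suspension_measure M) (suspension S) L F"
  then obtain F l where perp: "F \<in> L2_cube_perp M"
    and F: "L2_eigenfunction_at (suspension_measure M) (suspension S) L l F"
    by (auto simp: L2_eigenfunction_def)
  interpret prob_space M by fact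
  let ?C = "cube_measure :: (real ^ 'd) measure"
  interpret C: finite_measure ?C
    by (rule finite_measure_cube_measure)
  interpret P: pair_sigma_finite M ?C ..
  note act' = measure_preserving_actionD[OF act]
  note shift = distr_lattice_shift[OF \<open>prob_space M\<close> act C.sigma_finite_measure_axioms]
  define G where "G y = squash (F y)" for y
  define e where "e t = exp (2 * of_real pi * \<i> * of_real (l \<bullet> t))" for t
  have e: "e t * cnj (e t) = 1" "cmod (e t) = 1" for t
    by (simp_all add: complex_norm_square[symmetric] e_def)
  have [measurable]: "F \<in> borel_measurable (M \<Otimes>\<^sub>M ?C)"
    using F by (simp add: L2_eigenfunction_at_def L2_def suspension_measure_def)
  have Gm[measurable]: "G \<in> borel_measurable (M \<Otimes>\<^sub>M ?C)"
    unfolding G_def[abs_def] by measurable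
  have bound: "cmod (G y) \<le> 1" for y
    by (simp add: G_def cmod_squash_le_1)
  have eig: "AE y in M \<Otimes>\<^sub>M ?C. G (suspension S t y) = e t * G y" if "t \<in> L" for t
  proof -
    have "AE y in M \<Otimes>\<^sub>M ?C. F (suspension S t y) = e t * F y"
      using F that by (simp add: L2_eigenfunction_at_def suspension_measure_def e_def)
    then show ?thesis
      by eventually_elim (simp add: G_def squash_unit_mult e)
  qed
  have "\<exists>h. AE y in M \<Otimes>\<^sub>M ?C. G (S n (fst y), snd y) * cnj (G y) = h (snd y)" for n
  proof -
    define H where "H y = G (S n (fst y), snd y) * cnj (G y)" for y
    have [measurable]: "S n \<in> M \<rightarrow>\<^sub>M M"
      by (rule act')
    have Hm: "H \<in> borel_measurable (suspension_measure M)"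
      unfolding H_def[abs_def] suspension_measure_def by measurable
    have Hb: "cmod (H y) \<le> 1" for y
      unfolding H_def by (intro cmod_mult_cnj_le_1 bound)
    have Hinv: "AE y in suspension_measure M. H (suspension S t y) = H y" if t: "t \<in> L" for t
    proof -
      have "AE y in M \<Otimes>\<^sub>M ?C. G (suspension S t (S n (fst y), snd y)) = e t * G (S n (fst y), snd y)"
        using measure_preserving_AE[OF shift eig[OF t], of n] by (simp add: case_prod_beta')
      with eig[OF t] AE_space have "AE y in M \<Otimes>\<^sub>M ?C. H (suspension S t y) = H y"
      proof eventually_elim
        case (elim y)
        have "suspension S t (S n (fst y), snd y) = (S n (fst (suspension S t y)), snd (suspension S t y))"
          using elim(2) act'(5)[of "fst y"]
          by (auto simp: suspension_def case_prod_beta' space_pair_measure)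
        with elim have "H (suspension S t y) = (e t * cnj (e t)) * H y"
          by (simp add: H_def mult_ac)
        then show ?case
          by (simp add: e)
      qed
      then show ?thesis
        unfolding suspension_measure_def .
    qed
    have "AE y in suspension_measure M. H y = (\<integral>x. H (x, snd y) \<partial>M)"
      by (rule bounded_invariant_fibrewise_constant[OF \<open>prob_space M\<close> act ergodic Hm Hb Hinv])
    then show ?thesis
      by (intro exI[of _ "\<lambda>r. \<integral>x. H (x, r) \<partial>M"]) (simp only: H_def suspension_measure_def)
  qed
  then have "\<forall>n. \<exists>h. AE y in M \<Otimes>\<^sub>M ?C. G (S n (fst y), snd y) * cnj (G y) = h (snd y)"
    by (rule allI)
  from choice[OF this]
  obtain h where "\<forall>n. AE y in M \<Otimes>\<^sub>M ?C. G (S n (fst y), snd y) * cnj (G y) = h n (snd y)"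
    by (rule exE)
  \<comment> \<open>The lattice is countable, so one exceptional null set serves all integer times.\<close>
  then have "AE y in M \<Otimes>\<^sub>M ?C. \<forall>n. G (S n (fst y), snd y) * cnj (G y) = h n (snd y)"
    by (simp add: AE_all_countable)
  from AE_pair_swap[OF sigma_finite_measure_axioms C.sigma_finite_measure_axioms this]
  have "AE r in ?C. AE x in M. \<forall>n. G (S n x, r) * cnj (G (x, r)) = h n r"
    by simp
  then have "AE r in ?C. ae_constant M (\<lambda>x. F (x, r))"
    using AE_space
  proof eventually_elim
    case (elim r)
    have "(\<lambda>x. G (x, r)) \<in> borel_measurable M"
      using elim(2) by measurable
    then have "(\<lambda>x. G (x, r)) \<in> L2 M"
      by (rule bounded_measurable_in_L2[OF finite_measure_axioms _ bound])
    moreover have "\<exists>c. AE x in M. G (S n x, r) * cnj (G (x, r)) = c" for n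
      using elim(1) by (intro exI[of _ "h n r"]) (auto elim: eventually_mono)
    ultimately have "ae_constant M (\<lambda>x. G (x, r))"
      by (intro Zd_constant_if_autocorrelations_constant[OF \<open>prob_space M\<close> act mixing]) auto
    then show ?case
      unfolding G_def using \<open>prob_space M\<close> by (rule ae_constant_squash)
  qed
  from perp_fibrewise_constant_imp_zero[OF \<open>prob_space M\<close> perp this] F
  show False
    by (simp add: L2_eigenfunction_at_def)
qed

lemma Zd_ergodic_along_if_weak_mixing:
  "0 \<in> L \<Longrightarrow> Zd_weak_mixing_along M S L \<Longrightarrow> Zd_ergodic_along M S L"
  by (auto simp: Zd_ergodic_along_def Zd_weak_mixing_along_def L2_invariant_def L2_eigenfunction_def)

section \<open>Directional ergodicity and directional weak mixing\<close>

theorem theorem6p1: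
  fixes M :: "'a measure"
    and T :: "real ^ 'd \<Rightarrow> 'a \<Rightarrow> 'a"
    and S :: "int ^ 'd \<Rightarrow> 'a \<Rightarrow> 'a"
  assumes "lebesgue_probability_space M"
  shows "(Rd_action M T \<and> Rd_weak_mixing_along M T UNIV \<longrightarrow>
            directions (Rd_ergodic_along M T) = directions (Rd_weak_mixing_along M T) \<and>
            (\<forall>e\<in>{1..CARD('d)}. \<forall>L\<in>grassmannian e.
               Rd_ergodic_along M T L \<longleftrightarrow> Rd_weak_mixing_along M T L)) \<and>
         (Zd_action M S \<and> Zd_weak_mixing M S \<longrightarrow>
            directions (Zd_ergodic_along M S) = directions (Zd_weak_mixing_along M S) \<and>
            (\<forall>e\<in>{1..CARD('d)}. \<forall>L\<in>grassmannian e.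
               Zd_ergodic_along M S L \<longleftrightarrow> Zd_weak_mixing_along M S L))"
proof -
  have M: "prob_space M"
    using assms by (simp add: lebesgue_probability_space_def)
  have zero: "0 \<in> L" if "L \<in> grassmannian e" for e and L :: "(real ^ 'd) set"
    using that by (simp add: grassmannian_def subspace_0)
  have R: "Rd_ergodic_along M T L \<longleftrightarrow> Rd_weak_mixing_along M T L"
    if "Rd_action M T" "Rd_weak_mixing_along M T UNIV" "L \<in> grassmannian e" for e L
    using Rd_weak_mixing_along_if_ergodic[OF M that(1,2)] Rd_ergodic_along_if_weak_mixing[OF zero[OF that(3)]]
    by blast
  have Z: "Zd_ergodic_along M S L \<longleftrightarrow> Zd_weak_mixing_along M S L"
    if "Zd_action M S" "Zd_weak_mixing M S" "L \<in> grassmannian e" for e L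
    using Zd_weak_mixing_along_if_ergodic[OF M _ that(2)] that(1)
      Zd_ergodic_along_if_weak_mixing[OF zero[OF that(3)]]
    by (auto simp: Zd_action_def)
  have dirs: "directions P = directions Q"
    if "\<And>e L. L \<in> grassmannian e \<Longrightarrow> P L \<longleftrightarrow> Q L" for P Q :: "(real ^ 'd) set \<Rightarrow> bool"
    using that by (auto simp: directions_def)
  show ?thesis
    using R Z by (intro conjI impI ballI dirs) blast+
qed

end
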